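(* Let $k\ge1$, and let $J_1$ and $J_2$ be two Jacobi operators with perturbations $q_1,q_2\in\mathfrak X_k$, with corresponding phase shift functions $\xi_1$ and $\xi_2$. Let $(w_j)_{j=1}^k$ be a sequence of distinct numbers in $\mathbb C_-\cap\{|z|=1\}$, where $\mathbb C_-=\{\operatorname{Im}z<0\}$, such that $\xi_1(w_j)=\xi_2(w_j)$ for all $j\in\{1,\dots,k\}$. Then $J_1=J_2$.
   Context: $\mathbb N=\{1,2,\dots\}$. For real bounded sequences $(a_x)_{x\ge1}$, $(b_x)_{x\ge1}$ with $a_x>0$, the Jacobi operator $J$ on $\ell^2(\mathbb N)$ is $(Jf)_x=a_xf_{x+1}+b_xf_x+a_{x-1}f_{x-1}$, $x\ge1$, with $f_0=0$ formally and $a_0=1$. Its perturbation is $q=q(a,b)=(b_1,a_1-1,b_2,a_2-1,\dots)$. For $k\in\mathbb N$, $\mathfrak X_k=\{h\in\ell^\infty(\mathbb N)\ \text{real}:\ h_{2x}>-1\ \forall x\in\mathbb N,\ h_k\ne0,\ h_x=0\ \forall x>k\}$. For $q\in\mathfrak X_k$ with $k\in\{2p-1,2p\}$, the Jost solution $(\psi_x(z))_{x\ge0}$, $z\ne0$, is defined by $a_{x-1}\psi_{x-1}+a_x\psi_{x+1}+b_x\psi_x=(z+z^{-1})\psi_x$ for $x\ge1$ and $\psi_x(z)=z^x$ for $x>p$. The Jost function $\psi_0$ is a real polynomial of degree $k$ with $\psi_0(0)>0$; its zeros in $\mathbb D=\{|z|<1\}$ are real and simple, and its only possible zeros on $|z|=1$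 are $\pm1$. Let $s_1$ be its smallest zero in $(0,1)$ and $s_{-1}$ its largest zero in $(-1,0)$ (if one of them does not exist, the corresponding interval below is replaced by the single point $1$, respectively $-1$). The phase shift is $\xi(z)=\arg\psi_0(z)=\operatorname{Im}\log\psi_0(z)$, where $\log\psi_0$ is the continuous branch on $\overline{\mathbb D}\setminus([-1,s_{-1}]\cup[s_1,1])$ for which $\log\psi_0(0)$ is real. For $|z|=1$, $z\ne\pm1$, one has $\psi_0(z^{-1})/\psi_0(z)=e^{-2i\xi(z)}$. *)

theory Defs
  imports "HOL-Analysis.Analysis" "HOL-Computational_Algebra.Polynomial"
begin

text \<open>
  The index set is \<open>{1, 2, \<dots>}\<close>. Sequences are functions on \<^typ>\<open>nat\<close>; the additional
  entry at 0 carries the boundary conventions \<open>a\<^sub>0 = 1\<close> and \<open>f\<^sub>0 = 0\<close> where the theory uses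
  them. The entry \<open>b 0\<close> is never used.
\<close>

definition jacobi_coeffs :: "(nat \<Rightarrow> real) \<Rightarrow> (nat \<Rightarrow> real) \<Rightarrow> bool" where
  "jacobi_coeffs a b \<longleftrightarrow>
     bounded (range a) \<and> bounded (range b) \<and> (\<forall>x\<ge>1. a x > 0) \<and> a 0 = 1"

definition ell2 :: "(nat \<Rightarrow> complex) set" where
  "ell2 = {f. f 0 = 0 \<and> summable (\<lambda>x. (cmod (f x))\<^sup>2)}"

text \<open>
  The operator is extensional on \<^term>\<open>ell2\<close>, so equality of two such functions is equality
  of operators on \<open>\<ell>\<^sup>2\<close>.
\<close>

definition jacobi_operator ::
    "(nat \<Rightarrow> real) \<Rightarrow> (nat \<Rightarrow> real) \<Rightarrow> (nat \<Rightarrow> complex) \<Rightarrow> nat \<Rightarrow> complex" where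
  "jacobi_operator a b =
     restrict (\<lambda>f x. if x = 0 then 0
                     else of_real (a x) * f (x + 1) + of_real (b x) * f x
                            + of_real (a (x - 1)) * f (x - 1)) ell2"

text \<open>
  The sequence \<open>(b\<^sub>1, a\<^sub>1 - 1, b\<^sub>2, a\<^sub>2 - 1, \<dots>)\<close>, starting at index 1; its entry at 0 is
  \<open>a\<^sub>0 - 1 = 0\<close>.
\<close>

definition perturbation :: "(nat \<Rightarrow> real) \<Rightarrow> (nat \<Rightarrow> real) \<Rightarrow> nat \<Rightarrow> real" where
  "perturbation a b n = (if odd n then b ((n + 1) div 2) else a (n div 2) - 1)"

definition pert_class :: "nat \<Rightarrow> (nat \<Rightarrow> real) set" where
  "pert_class k =
     {h. h 0 = 0 \<and> bounded (range h) \<and> (\<forall>x\<ge>1. h (2 * x) > -1) \<and> h k \<noteq> 0 \<and> (\<forall>x>k. h x = 0)}"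

text \<open>Here \<open>(k + 1) div 2\<close> is the number \<open>p\<close> with \<open>k \<in> {2p - 1, 2p}\<close>.\<close>

definition is_jost_solution ::
    "nat \<Rightarrow> (nat \<Rightarrow> real) \<Rightarrow> (nat \<Rightarrow> real) \<Rightarrow> complex \<Rightarrow> (nat \<Rightarrow> complex) \<Rightarrow> bool" where
  "is_jost_solution k a b z \<psi> \<longleftrightarrow>
     (\<forall>x\<ge>1. of_real (a (x - 1)) * \<psi> (x - 1) + of_real (a x) * \<psi> (x + 1)
               + of_real (b x) * \<psi> x = (z + inverse z) * \<psi> x) \<and>
     (\<forall>x>(k + 1) div 2. \<psi> x = z ^ x)"

definition jost_solution ::
    "nat \<Rightarrow> (nat \<Rightarrow> real) \<Rightarrow> (nat \<Rightarrow> real) \<Rightarrow> complex \<Rightarrow> nat \<Rightarrow> complex" where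
  "jost_solution k a b z = (THE \<psi>. is_jost_solution k a b z \<psi>)"

text \<open>
  The Jost solution is only given for \<open>z \<noteq> 0\<close>. Its component at 0 is a real polynomial in \<open>z\<close>,
  and this polynomial gives the value of the Jost function at \<open>z = 0\<close>.
\<close>

definition jost_poly :: "nat \<Rightarrow> (nat \<Rightarrow> real) \<Rightarrow> (nat \<Rightarrow> real) \<Rightarrow> real poly" where
  "jost_poly k a b =
     (THE P. \<forall>z. z \<noteq> 0 \<longrightarrow> poly (map_poly of_real P) z = jost_solution k a b z 0)"

definition jost_function :: "nat \<Rightarrow> (nat \<Rightarrow> real) \<Rightarrow> (nat \<Rightarrow> real) \<Rightarrow> complex \<Rightarrow> complex" where
  "jost_function k a b z = poly (map_poly of_real (jost_poly k a b)) z"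

text \<open>
  When there is no zero in the interval in question, the values \<open>1\<close> and \<open>-1\<close> make the
  corresponding cut below the single point \<open>{1}\<close> or \<open>{-1}\<close>.
\<close>

definition smallest_pos_zero :: "nat \<Rightarrow> (nat \<Rightarrow> real) \<Rightarrow> (nat \<Rightarrow> real) \<Rightarrow> real" where
  "smallest_pos_zero k a b =
     (let Z = {s::real. 0 < s \<and> s < 1 \<and> jost_function k a b (of_real s) = 0}
      in if Z = {} then 1 else Min Z)"

definition largest_neg_zero :: "nat \<Rightarrow> (nat \<Rightarrow> real) \<Rightarrow> (nat \<Rightarrow> real) \<Rightarrow> real" where
  "largest_neg_zero k a b =
     (let Z = {s::real. -1 < s \<and> s < 0 \<and> jost_function k a b (of_real s) = 0}
      in if Z = {} then -1 else Max Z)"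

definition cut_disc :: "nat \<Rightarrow> (nat \<Rightarrow> real) \<Rightarrow> (nat \<Rightarrow> real) \<Rightarrow> complex set" where
  "cut_disc k a b =
     cball 0 1 - of_real ` ({-1..largest_neg_zero k a b} \<union> {smallest_pos_zero k a b..1})"

definition log_jost :: "nat \<Rightarrow> (nat \<Rightarrow> real) \<Rightarrow> (nat \<Rightarrow> real) \<Rightarrow> complex \<Rightarrow> complex" where
  "log_jost k a b =
     (THE L. L \<in> extensional (cut_disc k a b) \<and>
             continuous_on (cut_disc k a b) L \<and>
             (\<forall>z\<in>cut_disc k a b. exp (L z) = jost_function k a b z) \<and>
             L 0 \<in> \<real>)"

definition phase_shift :: "nat \<Rightarrow> (nat \<Rightarrow> real) \<Rightarrow> (nat \<Rightarrow> real) \<Rightarrow> complex \<Rightarrow> real" where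
  "phase_shift k a b z = Im (log_jost k a b z)"

end

theory Submission
  imports Defs
begin

text \<open>
  Everything is expressed through the solution \<open>u\<close> of the Jacobi recursion in the spectral
  parameter \<open>l = z + 1/z\<close> with \<open>u\<^sub>0 = 0\<close>, \<open>u\<^sub>1 = 1\<close>, rescaled so that \<open>u\<^sub>x\<^sub>+\<^sub>1\<close> is a monic real polynomial
  of degree \<open>x\<close> in \<open>l\<close>. With \<open>p\<close> the last site of the perturbation, constancy of the Wronskian
  of \<open>u\<close> and the Jost solution gives
  \<open>(a\<^sub>1 \<cdots> a\<^sub>p) \<psi>\<^sub>0(z) = z\<^bsup>p+1\<^esup> (u\<^sub>p\<^sub>+\<^sub>2(l) - z u\<^sub>p\<^sub>+\<^sub>1(l))\<close> (\<open>jost_function_eq\<close>).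

  This formula has two uses. First, the imaginary part of \<open>u\<^sub>x\<^sub>+\<^sub>1 cnj u\<^sub>x\<close> is a nonnegative
  multiple of \<open>Im l\<close>, which for \<open>\<bar>z\<bar> \<le> 1\<close> is zero or of sign opposite to \<open>Im z\<close>; hence \<open>\<psi>\<^sub>0\<close> has no non-real zero in the closed disc.
  The slit disc is star-shaped about 0, so the continuous logarithm exists and is unique, and the
  phase shift really is an argument of \<open>\<psi>\<^sub>0\<close>.

  Second, at \<open>\<bar>z\<bar> = 1\<close> the parameter \<open>l = 2 Re z\<close> is real. If the two Jost functions have the same
  argument at \<open>z\<close>, the product of one with the conjugate of the other is real. By the formula its
  imaginary part is, up to positive factors, \<open>Im z\<close> times the value at \<open>l\<close> of the cross product
  \<open>u\<^sub>p\<^sub>+\<^sub>2 v\<^sub>p\<^sub>+\<^sub>1 - u\<^sub>p\<^sub>+\<^sub>1 v\<^sub>p\<^sub>+\<^sub>2\<close> of the two monic solutions \<open>u\<close>, \<open>v\<close>. As both perturbations end at index \<open>k\<close>,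
  this real polynomial has degree below \<open>k\<close> (\<open>degree_cross_poly\<close>). The points of the lower half
  circle have distinct real parts, so \<open>k\<close> of them force the cross product to vanish identically.

  Finally \<open>u\<^sub>p\<^sub>+\<^sub>2 / u\<^sub>p\<^sub>+\<^sub>1 = v\<^sub>p\<^sub>+\<^sub>2 / v\<^sub>p\<^sub>+\<^sub>1\<close> determines all coefficients: expanding at infinity and
  descending in the index is the continued fraction expansion of the Jacobi matrix, and it is
  carried out on coefficients in \<open>inverse_recursion\<close>.
\<close>

section \<open>Monic regular solutions and the inverse problem for them\<close>

fun monic_solution :: "(nat \<Rightarrow> real) \<Rightarrow> (nat \<Rightarrow> real) \<Rightarrow> complex \<Rightarrow> nat \<Rightarrow> complex" where
  "monic_solution a b l 0 = 0"
| "monic_solution a b l (Suc 0) = 1"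
| "monic_solution a b l (Suc (Suc n)) =
     (l - of_real (b (Suc n))) * monic_solution a b l (Suc n)
     - of_real ((a n)\<^sup>2) * monic_solution a b l n"

text \<open>
  The same recursion for real polynomials in the spectral parameter. Degrees and coefficients are
  counted here, while the complex version serves non-real spectral parameters.
\<close>

fun orth_poly :: "(nat \<Rightarrow> real) \<Rightarrow> (nat \<Rightarrow> real) \<Rightarrow> nat \<Rightarrow> real poly" where
  "orth_poly a b 0 = 0"
| "orth_poly a b (Suc 0) = 1"
| "orth_poly a b (Suc (Suc n)) =
     pCons 0 (orth_poly a b (Suc n)) - smult (b (Suc n)) (orth_poly a b (Suc n))
     - smult ((a n)\<^sup>2) (orth_poly a b n)"

lemma monic_solution_of_real:
  "monic_solution a b (of_real t) n = of_real (poly (orth_poly a b n) t)"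
  by (induction a b "complex_of_real t" n rule: monic_solution.induct) (auto simp: algebra_simps)

lemma coeff_orth_poly_eq_0: "n \<le> i \<Longrightarrow> coeff (orth_poly a b n) i = 0"
proof (induction a b n arbitrary: i rule: orth_poly.induct)
  case (3 a b n)
  then show ?case by (cases i) auto
qed auto

lemma coeff_orth_poly_lead: "coeff (orth_poly a b (Suc n)) n = 1"
  by (induction n) (auto simp: coeff_orth_poly_eq_0)

lemma degree_orth_poly_Suc: "degree (orth_poly a b (Suc n)) = n"
  by (rule antisym, rule degree_le, simp add: coeff_orth_poly_eq_0,
      rule le_degree, simp add: coeff_orth_poly_lead)

lemma degree_orth_poly_le: "degree (orth_poly a b n) \<le> n - 1"
  by (cases n) (simp_all add: degree_orth_poly_Suc)

text \<open>
  The discrete Wronskian of two regular solutions; it vanishes for \<open>n \<ge> 1\<close> exactly when the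
  quotients of consecutive terms agree.
\<close>

definition cross_poly ::
    "(nat \<Rightarrow> real) \<Rightarrow> (nat \<Rightarrow> real) \<Rightarrow> (nat \<Rightarrow> real) \<Rightarrow> (nat \<Rightarrow> real) \<Rightarrow> nat \<Rightarrow> real poly" where
  "cross_poly a1 b1 a2 b2 n =
     orth_poly a1 b1 (Suc n) * orth_poly a2 b2 n - orth_poly a1 b1 n * orth_poly a2 b2 (Suc n)"

text \<open>
  The terms with the factor \<open>l\<close> cancel. What is left exhibits the differences of the coefficients,
  and each summand has smaller degree than the two products in the definition.
\<close>

lemma cross_poly_Suc:
  "cross_poly a1 b1 a2 b2 (Suc n) =
     smult (b2 (Suc n) - b1 (Suc n)) (orth_poly a1 b1 (Suc n) * orth_poly a2 b2 (Suc n))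
     + smult ((a2 n)\<^sup>2) (orth_poly a1 b1 (Suc n) * orth_poly a2 b2 n)
     - smult ((a1 n)\<^sup>2) (orth_poly a1 b1 n * orth_poly a2 b2 (Suc n))"
  by (simp add: cross_poly_def algebra_simps smult_diff_left smult_diff_right)

lemma coeff_orth_poly_mult_lead:
  "coeff (orth_poly a1 b1 (Suc m) * orth_poly a2 b2 (Suc n)) (m + n) = 1"
  using coeff_mult_degree_sum[of "orth_poly a1 b1 (Suc m)" "orth_poly a2 b2 (Suc n)"]
  by (simp add: degree_orth_poly_Suc coeff_orth_poly_lead)

lemma coeff_orth_poly_mult_eq_0:
  assumes "m + n \<le> Suc i"
  shows "coeff (orth_poly a1 b1 m * orth_poly a2 b2 n) i = 0"
proof (cases "m = 0 \<or> n = 0")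
  case False
  then have "degree (orth_poly a1 b1 m * orth_poly a2 b2 n) \<le> (m - 1) + (n - 1)"
    by (meson add_mono degree_mult_le degree_orth_poly_le order_trans)
  also have "\<dots> < i" using assms False by linarith
  finally show ?thesis by (rule coeff_eq_0)
qed auto

text \<open>
  The Jacobi coefficients can be read off the quotient of the last two polynomials. In
  \<open>cross_poly_Suc\<close> the first summand has degree \<open>2 n\<close> and the other two have degree \<open>2 n - 1\<close>, so
  the coefficient at \<open>2 n\<close> compares the diagonal entries. Once these agree, the coefficient at
  \<open>2 n - 1\<close> compares the squares of the off-diagonal entries, as all polynomials are monic. Then the
  cross product with index one less vanishes as well, and the descent continues.
\<close>

lemma inverse_recursion:
  assumes "cross_poly a1 b1 a2 b2 (Suc n) = 0"
    and pos: "\<And>x. a1 x > 0" "\<And>x. a2 x > 0"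
  shows "(\<forall>x\<in>{1..Suc n}. b1 x = b2 x) \<and> (\<forall>x\<in>{1..n}. a1 x = a2 x)"
  using assms(1)
proof (induction n)
  case (0)
  have "coeff (cross_poly a1 b1 a2 b2 (Suc 0)) 0 = b2 1 - b1 1"
    by (simp add: cross_poly_Suc)
  then show ?case using 0 by auto
next
  case (Suc n)
  define m where "m = Suc n"
  have "coeff (cross_poly a1 b1 a2 b2 (Suc m)) (m + m) = b2 (Suc m) - b1 (Suc m)"
    unfolding cross_poly_Suc
    by (simp add: coeff_orth_poly_mult_lead coeff_orth_poly_mult_eq_0)
  then have b: "b1 (Suc m) = b2 (Suc m)" using Suc.prems by (simp add: m_def)
  have "coeff (cross_poly a1 b1 a2 b2 (Suc m)) (m + n) = (a2 m)\<^sup>2 - (a1 m)\<^sup>2"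
    unfolding cross_poly_Suc using b coeff_orth_poly_mult_lead[of a1 b1 m a2 b2 n]
      coeff_orth_poly_mult_lead[of a1 b1 n a2 b2 m]
    by (simp add: m_def add.commute)
  then have "(a1 m)\<^sup>2 = (a2 m)\<^sup>2" using Suc.prems by (simp add: m_def)
  then have a: "a1 m = a2 m" using pos[of m] by (simp add: power2_eq_iff_nonneg less_imp_le)
  have "smult ((a1 m)\<^sup>2) (cross_poly a1 b1 a2 b2 m) = cross_poly a1 b1 a2 b2 (Suc m)"
    unfolding cross_poly_Suc[of _ _ _ _ m] by (simp add: a b cross_poly_def smult_diff_right)
  then have "cross_poly a1 b1 a2 b2 m = 0"
    using Suc.prems pos(1)[of m] by (simp add: m_def)
  then have IH: "\<forall>x\<in>{1..m}. b1 x = b2 x" "\<forall>x\<in>{1..n}. a1 x = a2 x"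
    using Suc.IH by (simp_all add: m_def)
  have "{1..Suc m} = insert (Suc m) {1..m}" "{1..m} = insert m {1..n}"
    unfolding m_def by (simp_all add: atLeastAtMostSuc_conv)
  then show ?case using IH a b unfolding m_def by (metis insert_iff)
qed

section \<open>The Jost function in terms of the regular solution\<close>

text \<open>
  This is \<open>z\<^bsup>n-1\<^esup> u\<^sub>n(z + 1/z)\<close>, written as a recursion that visibly produces polynomials in \<open>z\<close>.
  It shows that the Jost function is a polynomial and gives its value at 0, where \<open>z + 1/z\<close>
  is meaningless.
\<close>

fun scaled_poly :: "(nat \<Rightarrow> real) \<Rightarrow> (nat \<Rightarrow> real) \<Rightarrow> nat \<Rightarrow> real poly" where
  "scaled_poly a b 0 = 0"
| "scaled_poly a b (Suc 0) = 1"
| "scaled_poly a b (Suc (Suc n)) =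
     scaled_poly a b (Suc n)
     + pCons 0 (pCons 0 (scaled_poly a b (Suc n)) - smult (b (Suc n)) (scaled_poly a b (Suc n))
                - smult ((a n)\<^sup>2) (pCons 0 (scaled_poly a b n)))"

lemma poly_of_real_linear:
  fixes z :: complex
  shows "poly (map_poly of_real (P + Q)) z = poly (map_poly of_real P) z + poly (map_poly of_real Q) z"
    and "poly (map_poly of_real (P - Q)) z = poly (map_poly of_real P) z - poly (map_poly of_real Q) z"
    and "poly (map_poly of_real (smult c P)) z = of_real c * poly (map_poly of_real P) z"
    and "poly (map_poly of_real (pCons c P)) z = of_real c + z * poly (map_poly of_real P) z"
proof -
  have "map_poly of_real (P + Q) = (map_poly of_real P + map_poly of_real Q :: complex poly)"
       "map_poly of_real (P - Q) = (map_poly of_real P - map_poly of_real Q :: complex poly)"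
    by (auto intro!: poly_eqI simp: coeff_map_poly)
  then show "poly (map_poly of_real (P + Q)) z = poly (map_poly of_real P) z + poly (map_poly of_real Q) z"
    "poly (map_poly of_real (P - Q)) z = poly (map_poly of_real P) z - poly (map_poly of_real Q) z"
    by simp_all
qed (simp_all add: map_poly_smult map_poly_pCons)

lemma scaled_poly_eq:
  assumes "z \<noteq> 0"
  shows "z * poly (map_poly of_real (scaled_poly a b n)) z
         = z ^ n * monic_solution a b (z + inverse z) n"
proof (induction a b n rule: scaled_poly.induct)
  case (3 a b n)
  let ?R = "\<lambda>n. poly (map_poly of_real (scaled_poly a b n)) z"
  let ?u = "monic_solution a b (z + inverse z)"
  have "z * ?R (Suc (Suc n)) = (1 + z * z - of_real (b (Suc n)) * z) * (z * ?R (Suc n))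
          - of_real ((a n)\<^sup>2) * (z * z) * (z * ?R n)"
    by (simp add: poly_of_real_linear algebra_simps)
  also have "\<dots> = z ^ Suc (Suc n) * ?u (Suc (Suc n))"
    unfolding 3 using assms by (simp add: field_simps)
  finally show ?case .
qed auto

lemma poly_scaled_poly_0: "poly (scaled_poly a b (Suc n)) 0 = 1"
  by (induction n) auto

text \<open>
  Green's formula for \<open>u\<close> and its conjugate: for positive \<open>a\<close> the factor \<open>T\<close> is a positive multiple
  of the sum of \<open>\<bar>u\<^sub>j / (a\<^sub>1 \<cdots> a\<^sub>j\<^sub>-\<^sub>1)\<bar>\<^sup>2\<close> over \<open>1 \<le> j \<le> x\<close>. Only its sign matters, so the
  existential form suffices. Self-adjointness enters here: it keeps the zeros of the Jost function
  in the disc real.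
\<close>

lemma im_monic_solution:
  assumes "x \<ge> 1"
  shows "\<exists>T\<ge>0. Im (monic_solution a b l (Suc x) * cnj (monic_solution a b l x)) = Im l * T"
  using assms
proof (induction x rule: nat_induct_at_least)
  case base
  show ?case by (intro exI[of _ 1]) simp
next
  case (Suc x)
  let ?u = "monic_solution a b l"
  obtain T where T: "T \<ge> 0" "Im (?u (Suc x) * cnj (?u x)) = Im l * T" using Suc by blast
  have "Im (?u (Suc (Suc x)) * cnj (?u (Suc x)))
      = Im l * (cmod (?u (Suc x)))\<^sup>2 + (a x)\<^sup>2 * Im (?u (Suc x) * cnj (?u x))"
    by (simp only: cmod_power2) (simp add: algebra_simps power2_eq_square)
  also have "\<dots> = Im l * ((cmod (?u (Suc x)))\<^sup>2 + (a x)\<^sup>2 * T)"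
    unfolding T by (simp add: algebra_simps)
  finally show ?case
    using T(1) by (intro exI[of _ "(cmod (?u (Suc x)))\<^sup>2 + (a x)\<^sup>2 * T"]) simp
qed

text \<open>
  Since no \<open>a\<^sub>x\<close> vanishes the recursion can be run backwards, so two consecutive zeros would
  propagate down to \<open>u\<^sub>1 = 1\<close>.
\<close>

lemma monic_solution_no_consecutive_zeros:
  assumes "\<And>x. a x > 0"
  shows "monic_solution a b l n \<noteq> 0 \<or> monic_solution a b l (Suc n) \<noteq> 0"
proof (induction n)
  case (Suc n)
  have "a n \<noteq> 0" using assms[of n] by simp
  then show ?case using Suc by (cases "monic_solution a b l (Suc n) = 0") simp_all
qed simp

text \<open>
  The perturbation ends at index \<open>k\<close>. Stated by index rather than by site, the conditions treat
  both parities of \<open>k\<close> at once: for odd \<open>k\<close> they include \<open>a p = 1\<close> for the last perturbed site \<open>p\<close>.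
\<close>

locale finite_range_jacobi =
  fixes k :: nat and a b :: "nat \<Rightarrow> real"
  assumes a_pos: "a x > 0" and a_0: "a 0 = 1"
    and a_eq_1: "k < 2 * x \<Longrightarrow> a x = 1" and b_eq_0: "Suc k < 2 * x \<Longrightarrow> b x = 0"
begin

abbreviation p where "p \<equiv> (k + 1) div 2"

lemma beyond_range: "x > p \<Longrightarrow> a x = 1" "x > p \<Longrightarrow> b x = 0"
  by (simp_all add: a_eq_1 b_eq_0 div_less_iff_less_mult)

text \<open>
  Start from the free solution \<open>z ^ x\<close> beyond the perturbation and solve the recursion downwards,
  one site at a time.
\<close>

lemma jost_solution_exists:
  assumes "z \<noteq> 0"
  shows "\<exists>\<psi>. is_jost_solution k a b z \<psi>"
proof -
  have "\<exists>\<psi>. (\<forall>x>p + 1 - d. of_real (a (x - 1)) * \<psi> (x - 1) + of_real (a x) * \<psi> (x + 1)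
               + of_real (b x) * \<psi> x = (z + inverse z) * \<psi> x) \<and> (\<forall>x>p. \<psi> x = z ^ x)"
    if "d \<le> p + 1" for d
    using that
  proof (induction d)
    case 0
    have "z ^ (x - 1) + z ^ (x + 1) = (z + inverse z) * z ^ x" if "x > p + 1" for x
      using assms that by (cases x) (auto simp: field_simps)
    then show ?case by (intro exI[of _ "\<lambda>x. z ^ x"]) (auto simp: beyond_range)
  next
    case (Suc d)
    define y where "y = p + 1 - d"
    have y: "y \<ge> 1" "p + 1 - Suc d = y - 1" "y \<le> p + 1" using Suc.prems by (auto simp: y_def)
    obtain \<psi> where \<psi>: "\<forall>x>y. of_real (a (x - 1)) * \<psi> (x - 1) + of_real (a x) * \<psi> (x + 1)
               + of_real (b x) * \<psi> x = (z + inverse z) * \<psi> x" "\<forall>x>p. \<psi> x = z ^ x"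
      using Suc by (auto simp: y_def)
    define c where "c = ((z + inverse z) * \<psi> y - of_real (a y) * \<psi> (y + 1)
               - of_real (b y) * \<psi> y) / of_real (a (y - 1))"
    have c: "of_real (a (y - 1)) * c = (z + inverse z) * \<psi> y - of_real (a y) * \<psi> (y + 1)
               - of_real (b y) * \<psi> y"
      using a_pos[of "y - 1"] by (simp add: c_def)
    show ?case unfolding y(2)
    proof (intro exI[of _ "\<psi>(y - 1 := c)"] conjI allI impI)
      fix x assume "x > y - 1"
      then consider "x = y" | "x > y" by linarith
      then show "of_real (a (x - 1)) * (\<psi>(y - 1 := c)) (x - 1) + of_real (a x) * (\<psi>(y - 1 := c)) (x + 1)
               + of_real (b x) * (\<psi>(y - 1 := c)) x = (z + inverse z) * (\<psi>(y - 1 := c)) x"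
      proof cases
        case 1
        then show ?thesis using c y(1) by (auto simp: algebra_simps)
      next
        case 2
        then have "x - 1 \<noteq> y - 1" "x + 1 \<noteq> y - 1" "x \<noteq> y - 1" using y(1) by auto
        then show ?thesis using \<psi>(1) 2 by simp
      qed
    next
      fix x assume "x > p"
      then show "(\<psi>(y - 1 := c)) x = z ^ x" using \<psi>(2) y by auto
    qed
  qed
  from this[of "p + 1"] show ?thesis by (auto simp: is_jost_solution_def Suc_le_eq)
qed

lemma jost_solution_unique:
  assumes "is_jost_solution k a b z \<psi>" "is_jost_solution k a b z \<phi>"
  shows "\<psi> = \<phi>"
proof -
  have "\<forall>x. p < x + d \<longrightarrow> \<psi> x = \<phi> x" for d
  proof (induction d)
    case 0
    show ?case using assms by (simp add: is_jost_solution_def)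
  next
    case (Suc d)
    show ?case
    proof (intro allI impI)
      fix x assume "p < x + Suc d"
      then have up: "\<psi> (Suc x) = \<phi> (Suc x)" "\<psi> (Suc (Suc x)) = \<phi> (Suc (Suc x))"
        using Suc by simp_all
      have "of_real (a x) * f x = (z + inverse z) * f (Suc x)
          - of_real (a (Suc x)) * f (Suc (Suc x)) - of_real (b (Suc x)) * f (Suc x)"
        if "is_jost_solution k a b z f" for f
      proof -
        have "of_real (a (Suc x - 1)) * f (Suc x - 1) + of_real (a (Suc x)) * f (Suc x + 1)
            + of_real (b (Suc x)) * f (Suc x) = (z + inverse z) * f (Suc x)"
          using that unfolding is_jost_solution_def by (metis Suc_eq_plus1 le_add2)
        then show ?thesis by (simp add: algebra_simps)
      qed
      from this[OF assms(1)] this[OF assms(2)]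
      have "of_real (a x) * \<psi> x = of_real (a x) * \<phi> x" unfolding up by simp
      then show "\<psi> x = \<phi> x" using a_pos[of x] by simp
    qed
  qed
  from this[of "Suc p"] show ?thesis by auto
qed

text \<open>
  The Wronskian of the Jost solution and the regular solution is constant. The regular solution
  here is the monic one, which accounts for the product of the \<open>a i\<close>; evaluation at \<open>x = 0\<close> gives the
  Jost function because \<open>u\<^sub>0 = 0\<close>, \<open>u\<^sub>1 = 1\<close> and \<open>a\<^sub>0 = 1\<close>.
\<close>

lemma jost_solution_wronskian:
  assumes "is_jost_solution k a b z \<psi>"
  shows "\<psi> x * monic_solution a b (z + inverse z) (Suc x)
           - of_real (a x) * \<psi> (Suc x) * monic_solution a b (z + inverse z) x
         = of_real (\<Prod>i<x. a i) * \<psi> 0"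
proof (induction x)
  case (Suc x)
  let ?u = "monic_solution a b (z + inverse z)"
  have eq: "of_real (a x) * \<psi> x + of_real (a (Suc x)) * \<psi> (Suc (Suc x))
          + of_real (b (Suc x)) * \<psi> (Suc x) = (z + inverse z) * \<psi> (Suc x)"
    using assms unfolding is_jost_solution_def by (metis Suc_eq_plus1 diff_Suc_1 le_add2)
  have "\<psi> (Suc x) * ?u (Suc (Suc x)) - of_real (a (Suc x)) * \<psi> (Suc (Suc x)) * ?u (Suc x)
    = of_real (a x) * (\<psi> x * ?u (Suc x) - of_real (a x) * \<psi> (Suc x) * ?u x)
      + ?u (Suc x) * ((z + inverse z) * \<psi> (Suc x) - (of_real (a x) * \<psi> x
        + of_real (a (Suc x)) * \<psi> (Suc (Suc x)) + of_real (b (Suc x)) * \<psi> (Suc x)))"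
    by (simp add: algebra_simps power2_eq_square)
  then show ?case unfolding Suc eq by (simp add: mult_ac)
qed simp

definition prod_a where "prod_a = (\<Prod>i<Suc p. a i)"

lemma prod_a_pos: "prod_a > 0"
  unfolding prod_a_def by (intro prod_pos) (auto simp: a_pos)

text \<open>
  Evaluate the Wronskian at \<open>x = p + 1\<close>, where the Jost solution is explicit.
\<close>

lemma jost_solution_0:
  assumes "z \<noteq> 0"
  shows "of_real prod_a * jost_solution k a b z 0 = z ^ Suc p *
     (monic_solution a b (z + inverse z) (Suc (Suc p)) - z * monic_solution a b (z + inverse z) (Suc p))"
proof -
  have "\<exists>!\<psi>. is_jost_solution k a b z \<psi>"
    using jost_solution_exists[OF assms] jost_solution_unique by blast
  then have *: "is_jost_solution k a b z (jost_solution k a b z)"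
    unfolding jost_solution_def by (rule theI')
  then have "jost_solution k a b z (Suc p) = z ^ Suc p"
    "jost_solution k a b z (Suc (Suc p)) = z ^ Suc (Suc p)"
    unfolding is_jost_solution_def by simp_all
  then show ?thesis
    using jost_solution_wronskian[OF *, of "Suc p"]
    unfolding prod_a_def[symmetric]
    by (simp add: beyond_range algebra_simps del: prod.lessThan_Suc monic_solution.simps)
qed

lemma jost_poly_eq:
  "jost_poly k a b =
     smult (1 / prod_a) (scaled_poly a b (Suc (Suc p)) - pCons 0 (pCons 0 (scaled_poly a b (Suc p))))"
  (is "_ = ?P")
  unfolding jost_poly_def
proof (rule the_equality)
  have "of_real prod_a * poly (map_poly of_real ?P) z = of_real prod_a * jost_solution k a b z 0"
    if "z \<noteq> 0" for z
  proof -
    let ?R = "\<lambda>n. poly (map_poly of_real (scaled_poly a b n)) z"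
    have "z * (of_real prod_a * poly (map_poly of_real ?P) z) = z * ?R (Suc (Suc p)) - z * z * (z * ?R (Suc p))"
      using prod_a_pos by (simp add: poly_of_real_linear algebra_simps del: scaled_poly.simps)
    also have "\<dots> = z * (of_real prod_a * jost_solution k a b z 0)"
      unfolding scaled_poly_eq[OF that] jost_solution_0[OF that]
      by (simp add: algebra_simps del: monic_solution.simps)
    finally show ?thesis using that by simp
  qed
  then show *: "\<forall>z. z \<noteq> 0 \<longrightarrow> poly (map_poly of_real ?P) z = jost_solution k a b z 0"
    using prod_a_pos by simp
  fix P assume P: "\<forall>z. z \<noteq> 0 \<longrightarrow> poly (map_poly of_real P) z = jost_solution k a b z 0"
  have "poly (map_poly of_real (P - ?P)) z = 0" if "z \<noteq> (0::complex)" for z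
    using P * that unfolding poly_of_real_linear(2) by simp
  then have "- {0} \<subseteq> {z::complex. poly (map_poly of_real (P - ?P)) z = 0}" by auto
  moreover have "infinite (- {0::complex})"
    by (simp add: infinite_UNIV_char_0)
  ultimately have "map_poly of_real (P - ?P) = (0::complex poly)"
    using poly_roots_finite finite_subset by blast
  then have "P - ?P = 0" by (subst (asm) map_poly_eq_0_iff) auto
  then show "P = ?P" by simp
qed

lemma jost_function_eq:
  assumes "z \<noteq> 0"
  shows "of_real prod_a * jost_function k a b z = z ^ Suc p *
     (monic_solution a b (z + inverse z) (Suc (Suc p)) - z * monic_solution a b (z + inverse z) (Suc p))"
proof -
  let ?R = "\<lambda>n. poly (map_poly of_real (scaled_poly a b n)) z"
  have "z * (of_real prod_a * jost_function k a b z) = z * ?R (Suc (Suc p)) - z * z * (z * ?R (Suc p))"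
    using prod_a_pos by (simp add: jost_function_def jost_poly_eq poly_of_real_linear algebra_simps del: scaled_poly.simps)
  also have "\<dots> = z * (z ^ Suc p *
     (monic_solution a b (z + inverse z) (Suc (Suc p)) - z * monic_solution a b (z + inverse z) (Suc p)))"
    unfolding scaled_poly_eq[OF assms]
    by (simp add: algebra_simps del: monic_solution.simps)
  finally show ?thesis using assms by simp
qed

lemma jost_function_of_real: "jost_function k a b (of_real s) = of_real (poly (jost_poly k a b) s)"
proof -
  have "poly (map_poly of_real P) (complex_of_real s) = of_real (poly P s)" for P
    by (induction P) (auto simp: map_poly_pCons)
  then show ?thesis by (simp add: jost_function_def)
qed

lemma jost_function_0: "jost_function k a b 0 = of_real (1 / prod_a)"
  using jost_function_of_real[of 0]
  by (simp add: jost_poly_eq poly_scaled_poly_0 del: scaled_poly.simps)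

text \<open>
  At a zero, \<open>u\<^sub>p\<^sub>+\<^sub>2 = z u\<^sub>p\<^sub>+\<^sub>1\<close>, so the imaginary part in \<open>im_monic_solution\<close> equals
  \<open>Im z \<bar>u\<^sub>p\<^sub>+\<^sub>1\<bar>\<^sup>2\<close>. But it is also a nonnegative multiple of
  \<open>Im (z + 1/z) = Im z (1 - 1/\<bar>z\<bar>\<^sup>2)\<close>, which is zero or of sign opposite to \<open>Im z\<close>. Hence \<open>u\<^sub>p\<^sub>+\<^sub>1\<close> and \<open>u\<^sub>p\<^sub>+\<^sub>2\<close> both vanish, which is impossible. The argument covers the
  interior of the disc and the unit circle alike.
\<close>

lemma jost_function_nonzero_nonreal:
  assumes "cmod z \<le> 1" "Im z \<noteq> 0"
  shows "jost_function k a b z \<noteq> 0"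
proof
  assume 0: "jost_function k a b z = 0"
  have z: "z \<noteq> 0" using assms by auto
  let ?u = "monic_solution a b (z + inverse z)"
  have u: "?u (Suc (Suc p)) = z * ?u (Suc p)"
    using jost_function_eq[OF z] 0 z by (auto simp del: monic_solution.simps)
  obtain T where T: "T \<ge> 0" "Im (?u (Suc (Suc p)) * cnj (?u (Suc p))) = Im (z + inverse z) * T"
    using im_monic_solution[of "Suc p" a b "z + inverse z"] by auto
  have im_u: "Im (?u (Suc (Suc p)) * cnj (?u (Suc p))) = Im z * (cmod (?u (Suc p)))\<^sup>2"
    unfolding u cmod_power2 by (simp add: algebra_simps power2_eq_square del: monic_solution.simps)
  have im_l: "Im (z + inverse z) = Im z * (1 - 1 / (cmod z)\<^sup>2)"
    unfolding cmod_power2 by (simp add: algebra_simps)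
  have "Im z * (cmod (?u (Suc p)))\<^sup>2 = Im z * (1 - 1 / (cmod z)\<^sup>2) * T"
    using T(2) unfolding im_u im_l .
  then have "Im z * ((cmod (?u (Suc p)))\<^sup>2 + (1 / (cmod z)\<^sup>2 - 1) * T) = 0"
    by (simp only: ring_distribs)
  then have "(cmod (?u (Suc p)))\<^sup>2 + (1 / (cmod z)\<^sup>2 - 1) * T = 0" using assms by simp
  moreover have "1 / (cmod z)\<^sup>2 - 1 \<ge> 0"
    using assms(1) z by (simp add: power_le_one)
  then have "(1 / (cmod z)\<^sup>2 - 1) * T \<ge> 0" using T(1) by (rule mult_nonneg_nonneg)
  ultimately have "(cmod (?u (Suc p)))\<^sup>2 \<le> 0" by linarith
  then have "?u (Suc p) = 0" by simp
  with u monic_solution_no_consecutive_zeros[of a, OF a_pos] show False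
    by (metis mult_zero_right)
qed

section \<open>The logarithm of the Jost function on the slit disc\<close>

abbreviation cut_right where "cut_right \<equiv> smallest_pos_zero k a b"
abbreviation cut_left where "cut_left \<equiv> largest_neg_zero k a b"

lemma finite_zeros: "finite {s::real. jost_function k a b (of_real s) = 0}"
proof -
  have "jost_poly k a b \<noteq> 0"
    using jost_function_0 prod_a_pos by (auto simp: jost_function_def)
  then show ?thesis
    by (simp add: jost_function_of_real poly_roots_finite)
qed

lemma cut_right:
  "0 < cut_right" "cut_right \<le> 1"
  "\<And>s. 0 < s \<Longrightarrow> s < cut_right \<Longrightarrow> s < 1 \<Longrightarrow> jost_function k a b (of_real s) \<noteq> 0"
proof -
  let ?Z = "{s::real. 0 < s \<and> s < 1 \<and> jost_function k a b (of_real s) = 0}"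
  have fin: "finite ?Z" by (rule finite_subset[OF _ finite_zeros]) auto
  have "0 < cut_right \<and> cut_right \<le> 1"
  proof (cases "?Z = {}")
    case True
    then show ?thesis by (simp add: smallest_pos_zero_def Let_def)
  next
    case False
    then have "cut_right \<in> ?Z" using Min_in[OF fin] by (simp add: smallest_pos_zero_def Let_def)
    then show ?thesis by simp
  qed
  then show "0 < cut_right" "cut_right \<le> 1" by blast+
  fix s :: real assume "0 < s" "s < cut_right" "s < 1"
  then show "jost_function k a b (of_real s) \<noteq> 0"
    using Min_le[OF fin, of s] by (auto simp: smallest_pos_zero_def Let_def split: if_splits)
qed

lemma cut_left:
  "cut_left < 0" "-1 \<le> cut_left"
  "\<And>s. cut_left < s \<Longrightarrow> s < 0 \<Longrightarrow> -1 < s \<Longrightarrow> jost_function k a b (of_real s) \<noteq> 0"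
proof -
  let ?Z = "{s::real. -1 < s \<and> s < 0 \<and> jost_function k a b (of_real s) = 0}"
  have fin: "finite ?Z" by (rule finite_subset[OF _ finite_zeros]) auto
  have "cut_left < 0 \<and> -1 \<le> cut_left"
  proof (cases "?Z = {}")
    case True
    then show ?thesis by (simp add: largest_neg_zero_def Let_def)
  next
    case False
    then have "cut_left \<in> ?Z" using Max_in[OF fin] by (simp add: largest_neg_zero_def Let_def)
    then show ?thesis by simp
  qed
  then show "cut_left < 0" "-1 \<le> cut_left" by blast+
  fix s :: real assume "cut_left < s" "s < 0" "-1 < s"
  then show "jost_function k a b (of_real s) \<noteq> 0"
    using Max_ge[OF fin, of s] by (auto simp: largest_neg_zero_def Let_def split: if_splits)
qed

lemma cut_disc_iff:
  "z \<in> cut_disc k a b \<longleftrightarrow>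
     cmod z \<le> 1 \<and> (Im z = 0 \<longrightarrow> cut_left < Re z \<and> Re z < cut_right \<and> -1 < Re z \<and> Re z < 1)"
proof -
  have "w = of_real (Re w)" if "Im w = 0" for w
    using that by (simp add: complex_eq_iff)
  then have "w \<in> of_real ` S \<longleftrightarrow> Im w = 0 \<and> Re w \<in> S" for w S
    by (metis (no_types, lifting) Im_complex_of_real Re_complex_of_real image_iff)
  then have "z \<in> cut_disc k a b \<longleftrightarrow> cmod z \<le> 1 \<and>
      (Im z = 0 \<longrightarrow> \<not> (-1 \<le> Re z \<and> Re z \<le> cut_left) \<and> \<not> (cut_right \<le> Re z \<and> Re z \<le> 1))"
    unfolding cut_disc_def Diff_iff by simp
  moreover have "cmod z \<le> 1 \<Longrightarrow> -1 \<le> Re z \<and> Re z \<le> 1"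
    using abs_Re_le_cmod[of z] by linarith
  ultimately show ?thesis
    using cut_right(1,2) cut_left(1,2) by argo
qed

lemma jost_function_nonzero:
  assumes "z \<in> cut_disc k a b"
  shows "jost_function k a b z \<noteq> 0"
proof (cases "Im z = 0")
  case True
  then have "z = of_real (Re z)" by (simp add: complex_eq_iff)
  moreover have "Re z = 0 \<or> 0 < Re z \<or> Re z < 0" by auto
  ultimately show ?thesis
    using assms True cut_right(3)[of "Re z"] cut_left(3)[of "Re z"] jost_function_0 prod_a_pos
    unfolding cut_disc_iff
    by (metis of_real_0 of_real_eq_0_iff divide_eq_0_iff less_numeral_extra(3) zero_neq_one)
next
  case False
  then show ?thesis using assms jost_function_nonzero_nonreal by (auto simp: cut_disc_iff)
qed

lemma zero_in_cut_disc: "0 \<in> cut_disc k a b"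
  using cut_right(1) cut_left(1) by (simp add: cut_disc_iff)

lemma starlike_cut_disc: "starlike (cut_disc k a b)"
  unfolding starlike_def
proof (intro bexI[OF _ zero_in_cut_disc] ballI subsetI)
  fix z y assume z: "z \<in> cut_disc k a b" and "y \<in> closed_segment 0 z"
  then obtain t where t: "0 \<le> t" "t \<le> 1" "y = of_real t * z"
    by (auto simp: closed_segment_def scaleR_conv_of_real)
  show "y \<in> cut_disc k a b"
  proof (cases "t = 0")
    case True
    then show ?thesis using t zero_in_cut_disc by simp
  next
    case False
    have shrink: "t * r < s" if "r < s" "0 < s" for r s :: real
    proof (cases "r \<le> 0")
      case True
      then show ?thesis using that t by (meson mult_nonneg_nonpos order_le_less_trans)
    next
      case False
      then have "t * r \<le> 1 * r" using t by (intro mult_right_mono) auto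
      then show ?thesis using that by simp
    qed
    have "cmod y \<le> 1" using t z by (simp add: norm_mult cut_disc_iff mult_le_one)
    then show ?thesis
      using z t False shrink[of "Re z" cut_right] shrink[of "Re z" 1] shrink[of "- Re z" 1]
        shrink[of "- Re z" "- cut_left"] cut_right(1) cut_left(1)
      by (auto simp: cut_disc_iff)
  qed
qed

text \<open>
  The definite description of the logarithm denotes. Existence: the slit disc is contractible, and
  subtracting the value at 0 normalises a logarithm because the Jost function is positive there.
  Uniqueness: two logarithms differ by a continuous function with values in \<open>2 \<pi> \<i> \<int>\<close>, which is
  constant on the connected slit disc and 0 at the origin.
\<close>

lemma exp_log_jost:
  assumes "z \<in> cut_disc k a b"
  shows "exp (log_jost k a b z) = jost_function k a b z"
proof -
  let ?D = "cut_disc k a b" and ?P = "jost_function k a b"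
  let ?Q = "\<lambda>L. L \<in> extensional ?D \<and> continuous_on ?D L \<and> (\<forall>z\<in>?D. exp (L z) = ?P z) \<and> L 0 \<in> \<real>"
  have cont: "continuous_on ?D ?P" unfolding jost_function_def by (intro continuous_intros)
  obtain g where g: "continuous_on ?D g" "\<And>z. z \<in> ?D \<Longrightarrow> ?P z = exp (g z)"
    using continuous_logarithm_on_contractible[OF cont starlike_imp_contractible[OF starlike_cut_disc]]
      jost_function_nonzero by metis
  have P0: "exp (of_real (ln (1 / prod_a))) = ?P 0"
    using prod_a_pos unfolding jost_function_0 by (metis exp_ln exp_of_real zero_less_divide_1_iff)
  have "?Q (restrict (\<lambda>z. g z - g 0 + of_real (ln (1 / prod_a))) ?D)"
  proof (intro conjI)
    show "continuous_on ?D (restrict (\<lambda>z. g z - g 0 + of_real (ln (1 / prod_a))) ?D)"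
      by (subst continuous_on_cong[OF refl]) (auto intro!: continuous_intros g)
    show "\<forall>z\<in>?D. exp (restrict (\<lambda>z. g z - g 0 + of_real (ln (1 / prod_a))) ?D z) = ?P z"
      using g(2) P0 zero_in_cut_disc by (simp add: exp_add exp_diff)
  qed (auto simp: zero_in_cut_disc)
  moreover have "L = M" if L: "?Q L" and M: "?Q M" for L M
  proof -
    have "L 0 = M 0"
      using L M zero_in_cut_disc by (metis Reals_cases exp_inj_iff exp_of_real of_real_eq_iff)
    have "(\<lambda>z. L z - M z) constant_on ?D"
    proof (rule continuous_discrete_range_constant)
      show "connected ?D" by (rule starlike_imp_connected[OF starlike_cut_disc])
      show "continuous_on ?D (\<lambda>z. L z - M z)" using L M by (intro continuous_intros) auto
      fix x assume x: "x \<in> ?D"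
      have "2 * pi \<le> cmod (L y - M y - (L x - M x))" if y: "y \<in> ?D" "L y - M y \<noteq> L x - M x" for y
      proof -
        have "exp (L y - M y - (L x - M x)) = exp 0"
          using L M x y(1) jost_function_nonzero by (simp add: exp_diff)
        then obtain n :: int where n: "L y - M y - (L x - M x) = of_real (2 * n * pi) * \<i>"
          unfolding exp_eq by auto
        then have "n \<noteq> 0" using y by auto
        then have "1 \<le> \<bar>real_of_int n\<bar>" by linarith
        then show ?thesis unfolding n by (simp add: norm_mult abs_mult)
      qed
      then show "\<exists>e>0. \<forall>y. y \<in> ?D \<and> L y - M y \<noteq> L x - M x \<longrightarrow> e \<le> cmod (L y - M y - (L x - M x))"
        by (intro exI[of _ "2 * pi"]) auto
    qed
    then have "L z = M z" if "z \<in> ?D" for z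
      using that zero_in_cut_disc \<open>L 0 = M 0\<close> unfolding constant_on_def by (metis eq_iff_diff_eq_0)
    then show ?thesis using L M by (intro extensionalityI[of L ?D M]) auto
  qed
  ultimately have "\<exists>!L. ?Q L" by blast
  from theI'[OF this] show ?thesis using assms unfolding log_jost_def by blast
qed

lemma jost_function_polar:
  assumes "Im z < 0" "cmod z = 1"
  shows "jost_function k a b z = of_real (cmod (jost_function k a b z)) * cis (phase_shift k a b z)"
proof -
  have "z \<in> cut_disc k a b" using assms by (auto simp: cut_disc_iff)
  from exp_log_jost[OF this, symmetric] show ?thesis
    unfolding phase_shift_def by (simp only: norm_exp_eq_Re exp_eq_polar[symmetric])
qed

end

section \<open>Phase shifts determine the operator\<close>

lemma finite_range_jacobiI:
  assumes "jacobi_coeffs a b" "perturbation a b \<in> pert_class k"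
  shows "finite_range_jacobi k a b"
proof
  have h: "perturbation a b n = 0" if "n > k" for n
    using assms(2) that by (simp add: pert_class_def)
  show "a x > 0" for x using assms(1) by (cases "x = 0") (auto simp: jacobi_coeffs_def)
  show "a 0 = 1" using assms(1) by (simp add: jacobi_coeffs_def)
  show "a x = 1" if "k < 2 * x" for x
    using h[OF that] by (simp add: perturbation_def)
  show "b x = 0" if "Suc k < 2 * x" for x
    using h[of "2 * x - 1"] that by (simp add: perturbation_def)
qed

lemma unit_circle_sum_inverse: "cmod z = 1 \<Longrightarrow> z + inverse z = of_real (2 * Re z)"
proof -
  assume "cmod z = 1"
  then have "z * cnj z = 1" by (simp add: complex_norm_square[symmetric])
  then have "inverse z = cnj z" by (rule inverse_unique)
  then show ?thesis by (simp only: complex_add_cnj)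
qed

text \<open>
  With \<open>l = 2 Re z\<close> real, the product of the first Jost function and the conjugate of the second is
  a positive multiple of \<open>(u\<^sub>p\<^sub>+\<^sub>2 - z u\<^sub>p\<^sub>+\<^sub>1) (v\<^sub>p\<^sub>+\<^sub>2 - cnj z v\<^sub>p\<^sub>+\<^sub>1)\<close>, whose imaginary part is \<open>Im z\<close>
  times the cross product. Equal arguments make the product real.
\<close>

lemma cross_poly_zero:
  assumes "finite_range_jacobi k a1 b1" "finite_range_jacobi k a2 b2"
    and z: "Im z < 0" "cmod z = 1" and eq: "phase_shift k a1 b1 z = phase_shift k a2 b2 z"
  shows "poly (cross_poly a1 b1 a2 b2 (Suc ((k + 1) div 2))) (2 * Re z) = 0"
proof -
  interpret J1: finite_range_jacobi k a1 b1 by fact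
  interpret J2: finite_range_jacobi k a2 b2 by fact
  let ?P = "jost_function k a1 b1 z" and ?Q = "jost_function k a2 b2 z"
  define m where "m = Suc ((k + 1) div 2)"
  define t where "t = 2 * Re z"
  let ?p = "poly (orth_poly a1 b1 m) t" and ?p' = "poly (orth_poly a1 b1 (Suc m)) t"
  let ?q = "poly (orth_poly a2 b2 m) t" and ?q' = "poly (orth_poly a2 b2 (Suc m)) t"
  have z0: "z \<noteq> 0" using z by auto
  have P: "of_real J1.prod_a * ?P = z ^ m * (of_real ?p' - z * of_real ?p)"
    using J1.jost_function_eq[OF z0] unfolding unit_circle_sum_inverse[OF z(2)] monic_solution_of_real
    by (simp add: m_def t_def del: orth_poly.simps)
  have Q: "of_real J2.prod_a * ?Q = z ^ m * (of_real ?q' - z * of_real ?q)"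
    using J2.jost_function_eq[OF z0] unfolding unit_circle_sum_inverse[OF z(2)] monic_solution_of_real
    by (simp add: m_def t_def del: orth_poly.simps)
  have "x * cnj y = of_real (r * r')" if "x = of_real r * cis s" "y = of_real r' * cis s" for x y r r' s
    using that by (simp add: cis_cnj cis_mult)
  from this[OF J1.jost_function_polar[OF z] J2.jost_function_polar[OF z, folded eq]]
  have "?P * cnj ?Q = of_real (cmod ?P * cmod ?Q)" .
  then have "(of_real J1.prod_a * ?P) * cnj (of_real J2.prod_a * ?Q)
      = of_real (J1.prod_a * J2.prod_a * (cmod ?P * cmod ?Q))"
    by (simp add: mult_ac)
  then have "Im ((of_real J1.prod_a * ?P) * cnj (of_real J2.prod_a * ?Q)) = 0"
    by (metis Im_complex_of_real)
  moreover have "(of_real J1.prod_a * ?P) * cnj (of_real J2.prod_a * ?Q)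
     = (z * cnj z) ^ m * ((of_real ?p' - z * of_real ?p) * cnj (of_real ?q' - z * of_real ?q))"
    unfolding P Q by (simp add: power_mult_distrib del: orth_poly.simps)
  moreover have "z * cnj z = 1" using z by (simp add: complex_norm_square[symmetric])
  ultimately have "Im ((of_real ?p' - z * of_real ?p) * cnj (of_real ?q' - z * of_real ?q)) = 0"
    by (metis mult_1 power_one)
  then have "Im z * (?p' * ?q - ?p * ?q') = 0" by (simp add: algebra_simps del: orth_poly.simps)
  then show ?thesis using z unfolding m_def t_def cross_poly_def by (simp del: orth_poly.simps)
qed

text \<open>
  The strict bound by \<open>k\<close> is what makes \<open>k\<close> sample points enough. Beyond the perturbation the
  diagonal term of \<open>cross_poly_Suc\<close> vanishes, which leaves degree at most \<open>2 p - 1\<close>. For odd \<open>k\<close>, where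
  \<open>k = 2 p - 1\<close>, this is one too many, but then \<open>a p = 1\<close> for both operators, and the cross
  product equals the preceding one, of degree at most \<open>2 p - 2\<close>.
\<close>

lemma degree_cross_poly:
  assumes "finite_range_jacobi k a1 b1" "finite_range_jacobi k a2 b2" "k \<ge> 1"
  shows "degree (cross_poly a1 b1 a2 b2 (Suc ((k + 1) div 2))) < k"
proof -
  interpret J1: finite_range_jacobi k a1 b1 by fact
  interpret J2: finite_range_jacobi k a2 b2 by fact
  let ?p = "(k + 1) div 2"
  have deg: "degree (orth_poly a1 b1 m * orth_poly a2 b2 n) < k"
    if "m + n \<le> Suc k" for m n
    using that assms(3) coeff_orth_poly_mult_eq_0[of m n _ a1 b1 a2 b2]
    by (intro le_less_trans[OF degree_le, of "k - 1"]) auto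
  have beyond: "cross_poly a1 b1 a2 b2 (Suc ?p) =
      smult ((a2 ?p)\<^sup>2) (orth_poly a1 b1 (Suc ?p) * orth_poly a2 b2 ?p)
      - smult ((a1 ?p)\<^sup>2) (orth_poly a1 b1 ?p * orth_poly a2 b2 (Suc ?p))"
    unfolding cross_poly_Suc by (simp add: J1.beyond_range J2.beyond_range)
  show ?thesis
  proof (cases "even k")
    case True
    then have "?p + Suc ?p \<le> Suc k" by presburger
    then show ?thesis unfolding beyond
      by (intro degree_diff_less le_less_trans[OF degree_smult_le] deg) auto
  next
    case False
    then obtain q where q: "?p = Suc q" "k = Suc (2 * q)" by (auto elim: oddE)
    have "cross_poly a1 b1 a2 b2 (Suc ?p) = cross_poly a1 b1 a2 b2 ?p"
      unfolding beyond using J1.a_eq_1[of ?p] J2.a_eq_1[of ?p] q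
      by (simp add: cross_poly_def del: orth_poly.simps)
    also have "\<dots> = cross_poly a1 b1 a2 b2 (Suc q)" using q by simp
    finally have "cross_poly a1 b1 a2 b2 (Suc ?p) = cross_poly a1 b1 a2 b2 (Suc q)" .
    moreover have "degree (cross_poly a1 b1 a2 b2 (Suc q)) < k"
      unfolding cross_poly_Suc using q(2)
      by (intro degree_diff_less degree_add_less le_less_trans[OF degree_smult_le] deg) auto
    ultimately show ?thesis by simp
  qed
qed

theorem corollary1p5:
  fixes k :: nat
    and a1 b1 a2 b2 :: "nat \<Rightarrow> real"
    and w :: "nat \<Rightarrow> complex"
  assumes "k \<ge> 1"
    and "jacobi_coeffs a1 b1" and "jacobi_coeffs a2 b2"
    and "perturbation a1 b1 \<in> pert_class k" and "perturbation a2 b2 \<in> pert_class k"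
    and "inj_on w {1..k}"
    and "\<And>j. j \<in> {1..k} \<Longrightarrow> Im (w j) < 0 \<and> cmod (w j) = 1"
    and "\<And>j. j \<in> {1..k} \<Longrightarrow> phase_shift k a1 b1 (w j) = phase_shift k a2 b2 (w j)"
  shows "jacobi_operator a1 b1 = jacobi_operator a2 b2"
proof -
  interpret J1: finite_range_jacobi k a1 b1 using assms by (intro finite_range_jacobiI)
  interpret J2: finite_range_jacobi k a2 b2 using assms by (intro finite_range_jacobiI)
  let ?p = "(k + 1) div 2"
  let ?D = "cross_poly a1 b1 a2 b2 (Suc ?p)"
  \<comment> \<open>On the lower half circle the real part determines the point.\<close>
  have "inj_on (\<lambda>j. 2 * Re (w j)) {1..k}"
  proof (rule inj_onI)
    fix i j assume ij: "i \<in> {1..k}" "j \<in> {1..k}" "2 * Re (w i) = 2 * Re (w j)"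
    have "(Re (w i))\<^sup>2 + (Im (w i))\<^sup>2 = (Re (w j))\<^sup>2 + (Im (w j))\<^sup>2"
      using assms(7)[OF ij(1)] assms(7)[OF ij(2)] by (simp add: cmod_power2[symmetric])
    then have "(- Im (w i))\<^sup>2 = (- Im (w j))\<^sup>2" using ij by simp
    then have "Im (w i) = Im (w j)"
      using assms(7)[OF ij(1)] assms(7)[OF ij(2)] by (subst (asm) power2_eq_iff_nonneg) auto
    then have "w i = w j" using ij(3) by (simp add: complex_eq_iff)
    then show "i = j" using ij(1,2) assms(6) by (simp add: inj_onD)
  qed
  then have "card ((\<lambda>j. 2 * Re (w j)) ` {1..k}) = k" by (simp add: card_image)
  \<comment> \<open>\<open>k\<close> distinct zeros against a degree below \<open>k\<close>.\<close>
  then have "?D = 0"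
    using degree_cross_poly[OF J1.finite_range_jacobi_axioms J2.finite_range_jacobi_axioms assms(1)]
      cross_poly_zero[OF J1.finite_range_jacobi_axioms J2.finite_range_jacobi_axioms] assms(7,8)
    by (intro poly_eqI_degree[of "(\<lambda>j. 2 * Re (w j)) ` {1..k}"]) auto
  from inverse_recursion[OF this J1.a_pos J2.a_pos]
  have within: "b1 x = b2 x" "a1 x = a2 x" if "1 \<le> x" "x \<le> ?p" for x
    using that by auto
  have b: "b1 x = b2 x" if "1 \<le> x" for x
    using that within(1)[of x] J1.beyond_range(2)[of x] J2.beyond_range(2)[of x]
    by (metis not_le)
  have a: "a1 x = a2 x" for x
    using within(2)[of x] J1.beyond_range(1)[of x] J2.beyond_range(1)[of x] J1.a_0 J2.a_0
    by (metis not_le less_one)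
  have "a1 = a2" using a by blast
  then show ?thesis unfolding jacobi_operator_def using b by (intro restrict_ext ext) auto
qed

end
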